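(* For each $0\le a\le b\le1$, the clipped-ReLU loss $\ell_{a,b}$ is proper. Moreover, if $\ell:[0,1]\times\{0,1\}\to\mathbb R$ is proper and both partial losses $\ell(\cdot,0)$ and $\ell(\cdot,1)$ are convex and $1$-Lipschitz on $[0,1]$, then there are constants $c,d\in\mathbb R$ and a finite nonnegative Borel measure $\nu_\ell$ on $\mathcal I=\{(a,b):0\le a\le b\le1\}$ such that for all $p\in[0,1]$ and $y\in\{0,1\}$ $$\ell(p,y)=c+dy+\int_{\mathcal I}\ell_{a,b}(p,y)\,d\nu_\ell(a,b),$$ and $\nu_\ell(\mathcal I)\le5$.
   Context: A binary loss $\ell:[0,1]\times\{0,1\}\to\mathbb R$ is proper if for every $p\in[0,1]$ the map $q\mapsto(1-p)\ell(q,0)+p\,\ell(q,1)$ is minimized over $[0,1]$ at $q=p$. With $(u)_+=\max\{u,0\}$, for $0\le a\le b\le1$ define $$\varphi_{a,b}(z)=(z-a)_+-(z-b)_+,\qquad F_{a,b}(p)=\tfrac12(p-a)_+^2-\tfrac12(p-b)_+^2,$$ $$\ell_{a,b}(p,y)=-F_{a,b}(p)-(y-p)\varphi_{a,b}(p).$$ *)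

theory Defs
  imports "HOL-Analysis.Analysis"
begin

text \<open>
  A binary loss is a function of type \<^typ>\<open>real \<Rightarrow> real \<Rightarrow> real\<close>, of which only the values at
  predictions in \<^term>\<open>{0..1::real}\<close> and labels in \<^term>\<open>{0, 1::real}\<close> matter. Labels are reals
  because they enter the loss formulas arithmetically.
\<close>

definition proper_loss :: "(real \<Rightarrow> real \<Rightarrow> real) \<Rightarrow> bool" where
  "proper_loss L \<longleftrightarrow>
     (\<forall>p\<in>{0..1}. \<forall>q\<in>{0..1}.
        (1 - p) * L p 0 + p * L p 1 \<le> (1 - p) * L q 0 + p * L q 1)"

definition pos_part :: "real \<Rightarrow> real" where
  "pos_part u = max u 0"

definition clip_phi :: "real \<Rightarrow> real \<Rightarrow> real \<Rightarrow> real" where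
  "clip_phi a b z = pos_part (z - a) - pos_part (z - b)"

definition clip_F :: "real \<Rightarrow> real \<Rightarrow> real \<Rightarrow> real" where
  "clip_F a b p = 1/2 * (pos_part (p - a))\<^sup>2 - 1/2 * (pos_part (p - b))\<^sup>2"

definition clipped_relu_loss :: "real \<Rightarrow> real \<Rightarrow> real \<Rightarrow> real \<Rightarrow> real" where
  "clipped_relu_loss a b p y = - clip_F a b p - (y - p) * clip_phi a b p"

definition index_set :: "(real \<times> real) set" where
  "index_set = {(a, b). 0 \<le> a \<and> a \<le> b \<and> b \<le> 1}"

end

theory Submission
  imports Defs
begin

text \<open>
  Write \<open>\<phi> = L(\<cdot>,0) - L(\<cdot>,1)\<close>. Properness makes \<open>\<phi>\<close> nondecreasing and a subgradient of the negated
  Bayes risk, so a proper loss is determined by \<open>\<phi>\<close> up to a term \<open>c + dy\<close>. It therefore suffices to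
  write \<open>\<phi>\<close> as a mixture of the clipped ramps. Both partial losses are convex with slopes
  in \<open>[-1,1]\<close>; if \<open>a(t)\<close> and \<open>b(t)\<close> are the points where their slopes reach the level \<open>t\<close>, then
  \<open>L(p,0)\<close> and \<open>L(p,1)\<close> are, up to the same linear term and additive constants, the integrals
  over \<open>t \<in> [-1,1]\<close> of \<open>(p - a(t))\<^sub>+\<close> and \<open>(p - b(t))\<^sub>+\<close>. Monotonicity of \<open>\<phi>\<close> gives \<open>a \<le> b\<close>, so the
  image of Lebesgue measure on \<open>[-1,1]\<close> under \<open>(a,b)\<close> represents \<open>L\<close>, with total mass 2.
\<close>

section \<open>Rigidity from small increments\<close>

text \<open>Bisection halves the bound: the increments of \<open>s\<close> over the two halves
  telescope while the factor \<open>q - p\<close> halves. This identifies functions sharing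
  subgradients without differentiating them.\<close>

lemma constant_if_le_monotone_increment:
  fixes D s :: "real \<Rightarrow> real"
  assumes D: "\<And>p q. \<lbrakk>0 \<le> p; p \<le> q; q \<le> 1\<rbrakk> \<Longrightarrow> \<bar>D q - D p\<bar> \<le> (q - p) * (s q - s p)"
    and p: "p \<in> {0..1}"
  shows "D p = D 0"
proof -
  have halve: "\<bar>D q - D p\<bar> \<le> (q - p) * (s q - s p) / 2 ^ n"
    if "0 \<le> p" "p \<le> q" "q \<le> 1" for n p q
    using that
  proof (induction n arbitrary: p q)
    case 0
    then show ?case using D by simp
  next
    case (Suc n)
    define m where "m = (p + q) / 2"
    have m: "0 \<le> m" "p \<le> m" "m \<le> q" "m \<le> 1" "m - p = (q - p) / 2" "q - m = (q - p) / 2"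
      using Suc.prems by (auto simp: m_def field_simps)
    have "\<bar>D q - D p\<bar> \<le> \<bar>D m - D p\<bar> + \<bar>D q - D m\<bar>" by linarith
    also have "\<dots> \<le> (m - p) * (s m - s p) / 2 ^ n + (q - m) * (s q - s m) / 2 ^ n"
      using Suc m by (intro add_mono) auto
    also have "\<dots> = (q - p) * (s q - s p) / 2 ^ Suc n"
      unfolding m by (simp add: field_simps)
    finally show ?case .
  qed
  have "(\<lambda>n. p * (s p - s 0) * (1 / 2) ^ n) \<longlonglongrightarrow> p * (s p - s 0) * 0"
    by (intro tendsto_mult tendsto_const LIMSEQ_power_zero) simp
  then have "\<bar>D p - D 0\<bar> \<le> 0"
    using halve[of 0 p] p
    by (intro tendsto_lowerbound[of _ _ sequentially]) (auto simp: power_divide)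
  then show ?thesis by simp
qed

section \<open>Clipped-ReLU losses\<close>

lemma pos_part_nonneg: "0 \<le> u \<Longrightarrow> pos_part u = u"
  and pos_part_nonpos: "u \<le> 0 \<Longrightarrow> pos_part u = 0"
  by (simp_all add: pos_part_def)

lemma clip_phi_bounds: "a \<le> b \<Longrightarrow> 0 \<le> clip_phi a b z \<and> clip_phi a b z \<le> b - a"
  by (auto simp: clip_phi_def pos_part_def)

text \<open>\<^const>\<open>clip_F\<close> is the conjugate of \<open>u \<mapsto> u\<^sup>2 / 2 + u a\<close> on \<open>[0, b - a]\<close>; the maximizer
  is \<^const>\<open>clip_phi\<close>.\<close>

lemma clip_F_ge:
  assumes "0 \<le> u" "u \<le> b - a"
  shows "u * (p - a) - u\<^sup>2 / 2 \<le> clip_F a b p"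
proof -
  consider "p \<le> a" | "a \<le> p" "p \<le> b" | "b \<le> p" by linarith
  then show ?thesis
  proof cases
    case 1
    then have "u * (p - a) \<le> 0" using assms by (simp add: mult_nonneg_nonpos)
    then have "u * (p - a) - u\<^sup>2 / 2 \<le> 0" by (smt (verit) zero_le_power2 divide_nonneg_pos)
    then show ?thesis using 1 assms by (simp add: clip_F_def pos_part_nonpos)
  next
    case 2
    have "0 \<le> (p - a - u)\<^sup>2" by simp
    then show ?thesis using 2
      by (simp add: clip_F_def pos_part_nonneg pos_part_nonpos power2_eq_square algebra_simps)
  next
    case 3
    \<comment> \<open>The gap between the two sides of the claim is half this product.\<close>
    have "0 \<le> (b - a - u) * ((p - b) + (p - a - u))"
      using assms 3 by (intro mult_nonneg_nonneg) auto
    then show ?thesis using 3 assms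
      by (simp add: clip_F_def pos_part_nonneg power2_eq_square algebra_simps)
  qed
qed

lemma clip_F_eq:
  assumes "a \<le> b"
  shows "clip_F a b p = clip_phi a b p * (p - a) - (clip_phi a b p)\<^sup>2 / 2"
  using assms
  by (auto simp: clip_F_def clip_phi_def pos_part_def max_def power2_eq_square field_simps)

text \<open>Under label probability \<open>p\<close>, the expected loss of predicting
  \<open>q\<close> is minus the tangent to \<open>clip_F a b\<close> at \<open>q\<close>, evaluated
  at \<open>p\<close>. By the conjugate form with \<open>u = clip_phi a b q\<close>, this tangent
  stays below \<open>clip_F a b\<close>, and it touches at \<open>q\<close>.\<close>

lemma proper_clipped_relu_loss:
  assumes "a \<le> b"
  shows "proper_loss (clipped_relu_loss a b)"
  unfolding proper_loss_def
proof (intro ballI)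
  fix p q :: real
  have "clip_F a b q + (p - q) * clip_phi a b q \<le> clip_F a b p"
    using clip_F_ge[of "clip_phi a b q" b a p] clip_phi_bounds[OF assms, of q]
    by (simp add: clip_F_eq[OF assms, of q] algebra_simps)
  then show "(1 - p) * clipped_relu_loss a b p 0 + p * clipped_relu_loss a b p 1
      \<le> (1 - p) * clipped_relu_loss a b q 0 + p * clipped_relu_loss a b q 1"
    by (simp add: clipped_relu_loss_def algebra_simps)
qed

section \<open>Proper losses and the difference of partial losses\<close>

lemma proper_loss_difference_mono:
  assumes "proper_loss L" "p \<in> {0..1}" "q \<in> {0..1}" "p \<le> q"
  shows "L p 0 - L p 1 \<le> L q 0 - L q 1"
proof (cases "p = q")
  case False
  have "(1 - p) * L p 0 + p * L p 1 \<le> (1 - p) * L q 0 + p * L q 1"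
    "(1 - q) * L q 0 + q * L q 1 \<le> (1 - q) * L p 0 + q * L p 1"
    using assms unfolding proper_loss_def by auto
  then have "0 \<le> (q - p) * ((L q 0 - L q 1) - (L p 0 - L p 1))"
    by (simp add: algebra_simps)
  then show ?thesis using False assms by (simp add: zero_le_mult_iff)
qed simp

text \<open>The increment of a Bayes risk from \<open>p\<close> to \<open>q\<close> lies between
  \<open>-(q - p)\<close> times the partial-loss difference at \<open>q\<close> and at
  \<open>p\<close>. Adding \<open>k * p\<close> to the risk of \<open>L\<close> gives it the same
  bounds as the risk of \<open>M\<close>, so the rigidity lemma applies to \<open>D\<close>.\<close>

lemma proper_losses_with_same_difference:
  assumes L: "proper_loss L" and M: "proper_loss M"
    and k: "\<And>p. p \<in> {0..1} \<Longrightarrow> L p 0 - L p 1 = M p 0 - M p 1 + k"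
  obtains c d where "\<And>p y. \<lbrakk>p \<in> {0..1}; y \<in> {0, 1}\<rbrakk> \<Longrightarrow> L p y = c + d * y + M p y"
proof -
  define D where
    "D p = ((1 - p) * L p 0 + p * L p 1) - ((1 - p) * M p 0 + p * M p 1) + k * p" for p
  have const: "D p = D 0" if "p \<in> {0..1}" for p
  proof (rule constant_if_le_monotone_increment[where s = "\<lambda>p. M p 0 - M p 1", OF _ that])
    fix p q :: real assume pq: "0 \<le> p" "p \<le> q" "q \<le> 1"
    have "(1 - p) * X p 0 + p * X p 1 \<le> (1 - p) * X q 0 + p * X q 1"
      "(1 - q) * X q 0 + q * X q 1 \<le> (1 - q) * X p 0 + q * X p 1" if "proper_loss X" for X
      using that pq unfolding proper_loss_def by auto
    note ineqs = this[OF L] this[OF M]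
    have eqs: "L p 1 = L p 0 - (M p 0 - M p 1 + k)" "L q 1 = L q 0 - (M q 0 - M q 1 + k)"
      using k[of p] k[of q] pq by auto
    show "\<bar>D q - D p\<bar> \<le> (q - p) * ((M q 0 - M q 1) - (M p 0 - M p 1))"
      using ineqs unfolding D_def eqs abs_le_iff by (simp add: algebra_simps)
  qed
  show thesis
  \<comment> \<open>With risk R and difference \<phi>, the partial losses are R + p\<phi> and R - (1
    - p)\<phi>. Hence \<open>L\<close> exceeds \<open>M\<close> by \<open>D 0\<close> at label 0 and
    by \<open>D 0 - k\<close> at label 1.\<close>
  proof (rule that[of "D 0" "- k"])
    fix p y :: real assume p: "p \<in> {0..1}" and y: "y \<in> {0, 1}"
    have eq: "L p 1 = L p 0 - (M p 0 - M p 1 + k)" using k[OF p] by simp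
    show "L p y = D 0 + - k * y + M p y"
      using const[OF p] y unfolding D_def[of p] eq by (auto simp: algebra_simps eq)
  qed
qed

section \<open>Slopes of convex 1-Lipschitz functions\<close>

text \<open>The right derivative on the open unit interval, with the extreme slopes of a 1-Lipschitz function
  at the endpoints.\<close>

definition slope :: "(real \<Rightarrow> real) \<Rightarrow> real \<Rightarrow> real" where
  "slope f p = (if p \<le> 0 then -1 else if 1 \<le> p then 1
     else Inf ((\<lambda>t. (f p - f t) / (p - t)) ` ({p<..} \<inter> {0..1})))"

lemma lipschitz_quotient_bounds:
  fixes f :: "real \<Rightarrow> real"
  assumes "1-lipschitz_on {0..1} f" "p \<in> {0..1}" "t \<in> {0..1}" "p < t"
  shows "-1 \<le> (f p - f t) / (p - t)" "(f p - f t) / (p - t) \<le> 1"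
  using lipschitz_onD[OF assms(1-3)] assms(4) by (auto simp: dist_real_def field_simps)

text \<open>At the endpoints the inequality is the Lipschitz bound itself, which is why -1 and 1 are
  admissible slopes there.\<close>

lemma slope_subgradient:
  assumes f: "convex_on {0..1} f" "1-lipschitz_on {0..1} f"
    and p: "p \<in> {0..1}" and q: "q \<in> {0..1}"
  shows "f p + slope f p * (q - p) \<le> f q"
proof -
  have lip: "\<bar>f p - f q\<bar> \<le> \<bar>p - q\<bar>"
    using lipschitz_onD[OF f(2) p q] by (simp add: dist_real_def)
  consider "p = 0" | "p = 1" | "p \<in> interior {0..1}" using p by fastforce
  then show ?thesis
  proof cases
    case 3
    from convex_le_Inf_differential[OF f(1) 3 q] 3 show ?thesis by (simp add: slope_def)
  qed (use lip p q in \<open>auto simp: slope_def\<close>)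
qed

lemma slope_bounds:
  assumes f: "convex_on {0..1} f" "1-lipschitz_on {0..1} f"
  shows "-1 \<le> slope f p" "slope f p \<le> 1"
proof -
  have "-1 \<le> slope f p \<and> slope f p \<le> 1"
  proof (cases "p \<le> 0 \<or> 1 \<le> p")
    case True
    then show ?thesis by (auto simp: slope_def)
  next
    case False
    then have p: "p \<in> {0..1}" "p < 1" "0 < p" by auto
    have "\<bar>f p - f 0\<bar> \<le> p" "\<bar>f p - f 1\<bar> \<le> 1 - p"
      using lipschitz_onD[OF f(2) p(1), of 0] lipschitz_onD[OF f(2) p(1), of 1] p
      by (auto simp: dist_real_def)
    then have "slope f p * (1 - p) \<le> 1 * (1 - p)" "- slope f p * p \<le> 1 * p"
      using slope_subgradient[OF f p(1), of 0] slope_subgradient[OF f p(1), of 1]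
      by (auto simp del: mult_le_cancel_right2)
    then have "slope f p \<le> 1" "- slope f p \<le> 1"
      using mult_right_le_imp_le[of "slope f p" "1 - p" 1] mult_right_le_imp_le[of "- slope f p" p 1] p
      by simp_all
    then show ?thesis by simp
  qed
  then show "-1 \<le> slope f p" "slope f p \<le> 1" by auto
qed

lemma slope_mono:
  assumes f: "convex_on {0..1} f" "1-lipschitz_on {0..1} f"
    and pq: "p \<in> {0..1}" "q \<in> {0..1}" "p \<le> q"
  shows "slope f p \<le> slope f q"
proof (cases "p = q")
  case False
  have "0 \<le> (q - p) * (slope f q - slope f p)"
    using slope_subgradient[OF f pq(1,2)] slope_subgradient[OF f pq(2,1)]
    by (simp add: algebra_simps)
  then show ?thesis using False pq by (simp add: zero_le_mult_iff)
qed simp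

text \<open>Each right difference quotient of \<open>g\<close> dominates that of \<open>f\<close>,
  so the infima compare; at the endpoints both slopes have the same assigned value.\<close>

lemma slope_le_slope:
  assumes f: "1-lipschitz_on {0..1} f"
    and mono: "\<And>p q. \<lbrakk>p \<in> {0..1}; q \<in> {0..1}; p \<le> q\<rbrakk> \<Longrightarrow> g p - f p \<le> g q - f q"
  shows "slope f p \<le> slope g p"
proof (cases "p \<le> 0 \<or> 1 \<le> p")
  case True
  then show ?thesis by (auto simp: slope_def)
next
  case False
  have "(INF t\<in>{p<..} \<inter> {0..1}. (f p - f t) / (p - t)) \<le> (INF t\<in>{p<..} \<inter> {0..1}. (g p - g t) / (p - t))"
  proof (rule cINF_mono)
    have "1 \<in> {p<..} \<inter> {0..1}" using False by auto
    then show "{p<..} \<inter> {0..1} \<noteq> {}" by blast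
    show "bdd_below ((\<lambda>t. (f p - f t) / (p - t)) ` ({p<..} \<inter> {0..1}))"
      using lipschitz_quotient_bounds(1)[OF f, of p] False by (intro bdd_belowI2[of _ "-1"]) auto
    show "\<exists>n\<in>{p<..} \<inter> {0..1}. (f p - f n) / (p - n) \<le> (g p - g t) / (p - t)"
      if "t \<in> {p<..} \<inter> {0..1}" for t
      using that mono[of p t] False by (intro bexI[of _ t] divide_right_mono_neg) auto
  qed
  then show ?thesis using False by (simp add: slope_def)
qed

section \<open>Generalized inverse of the slope\<close>

text \<open>The quantile-type inverse of the nondecreasing slope. The value 1 assigned to the slope
  at 1 keeps the set nonempty for all \<open>t \<le> 1\<close>.\<close>

definition slope_level :: "(real \<Rightarrow> real) \<Rightarrow> real \<Rightarrow> real" where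
  "slope_level f t = Inf {z \<in> {0..1}. t \<le> slope f z}"

lemma slope_level_set:
  assumes "t \<le> 1"
  shows "1 \<in> {z \<in> {0..1}. t \<le> slope f z}" "bdd_below {z \<in> {0..1}. t \<le> slope f z}"
  using assms by (auto simp: slope_def intro: bdd_belowI[of _ 0])

lemma slope_level_bounds:
  assumes "t \<le> 1"
  shows "0 \<le> slope_level f t" "slope_level f t \<le> 1"
proof -
  show "slope_level f t \<le> 1"
    unfolding slope_level_def by (rule cInf_lower[OF slope_level_set[OF assms]])
  show "0 \<le> slope_level f t"
    unfolding slope_level_def using slope_level_set(1)[OF assms] by (intro cInf_greatest) auto
qed

lemma slope_level_le:
  assumes "p \<in> {0..1}" "t \<le> slope f p"
  shows "slope_level f t \<le> p"
  unfolding slope_level_def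
  using assms by (intro cInf_lower) (auto intro: bdd_belowI[of _ 0])

text \<open>Converse of \<open>slope_level_le\<close> up to strictness: the infimum need not be
  attained, for example at 0, where the slope is set to -1.\<close>

lemma le_slope_if_slope_level_less:
  assumes f: "convex_on {0..1} f" "1-lipschitz_on {0..1} f"
    and "t \<le> 1" "p \<in> {0..1}" "slope_level f t < p"
  shows "t \<le> slope f p"
proof -
  obtain z where "z \<in> {0..1}" "t \<le> slope f z" "z < p"
    using cInf_lessD[OF _ assms(5)[unfolded slope_level_def]] slope_level_set(1)[OF assms(3)] by blast
  then show ?thesis using slope_mono[OF f, of z p] assms(4) by linarith
qed

lemma slope_level_mono: "mono_on {-1..1} (slope_level f)"
  unfolding slope_level_def
proof (intro mono_onI cInf_superset_mono)
  fix r t :: real assume "r \<in> {-1..1}" "t \<in> {-1..1}" "r \<le> t"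
  then show "{z \<in> {0..1}. t \<le> slope f z} \<noteq> {}" "bdd_below {z \<in> {0..1}. r \<le> slope f z}"
    "{z \<in> {0..1}. t \<le> slope f z} \<subseteq> {z \<in> {0..1}. r \<le> slope f z}"
    using slope_level_set[of t f] slope_level_set[of r f] by auto
qed

lemma slope_level_antimono:
  assumes "\<And>p. slope f p \<le> slope g p" "t \<le> 1"
  shows "slope_level g t \<le> slope_level f t"
  unfolding slope_level_def
proof (rule cInf_superset_mono)
  show "{z \<in> {0..1}. t \<le> slope f z} \<subseteq> {z \<in> {0..1}. t \<le> slope g z}"
    using assms(1) order_trans by blast
qed (use slope_level_set[OF assms(2), of f] slope_level_set[OF assms(2), of g] in auto)

section \<open>Integration over slope levels\<close>

abbreviation level_measure :: "real measure" where
  "level_measure \<equiv> restrict_space lborel {-1..1}"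

lemma finite_level_measure: "finite_measure level_measure"
  by (rule finite_measureI) (simp add: emeasure_restrict_space)

lemma measurable_slope_level [measurable]: "slope_level f \<in> borel_measurable level_measure"
proof -
  have "slope_level f \<in> borel_measurable (restrict_space borel {-1..1})"
    by (rule borel_measurable_mono_on_fnc[OF slope_level_mono])
  then show ?thesis
    by (subst measurable_cong_sets[OF sets_restrict_space_cong[OF sets_lborel] refl])
qed

lemma measurable_pos_part [measurable]: "pos_part \<in> borel_measurable borel"
  unfolding pos_part_def by measurable

lemma integrable_level_measure_bounded:
  fixes g :: "real \<Rightarrow> real"
  assumes "g \<in> borel_measurable level_measure" "\<And>t. t \<in> {-1..1} \<Longrightarrow> \<bar>g t\<bar> \<le> B"
  shows "integrable level_measure g"
  using assms
  by (intro finite_measure.integrable_const_bound[OF finite_level_measure, of _ B])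
    (auto simp: space_restrict_space)

lemma integrable_pos_part_slope_level:
  assumes "p \<in> {0..1}"
  shows "integrable level_measure (\<lambda>t. pos_part (p - slope_level f t))"
proof (rule integrable_level_measure_bounded[where B = 1])
  fix t :: real assume "t \<in> {-1..1}"
  then show "\<bar>pos_part (p - slope_level f t)\<bar> \<le> 1"
    using slope_level_bounds[of t f] assms by (auto simp: pos_part_def)
qed measurable

text \<open>The step functions that bound increments of the integrated ramps; \<open>s + 1\<close>
  is the length of [-1, s].\<close>

lemma integral_level_indicator:
  assumes "-1 \<le> s" "s \<le> 1"
  shows "integrable level_measure (\<lambda>t. h * indicator {..s} t :: real)"
    "(\<integral>t. h * indicator {..s} t \<partial>level_measure) = h * (s + 1)"
proof -
  show "integrable level_measure (\<lambda>t. h * indicator {..s} t :: real)"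
    by (rule integrable_level_measure_bounded[where B = "\<bar>h\<bar>"])
      (auto simp: indicator_def intro!: measurable_restrict_space1)
  have "{..s} \<inter> {-1..1} = {-1..s}" using assms by auto
  then show "(\<integral>t. h * indicator {..s} t \<partial>level_measure) = h * (s + 1)"
    using assms by (simp add: space_restrict_space measure_restrict_space)
qed

text \<open>Layer-cake formula: the levels \<open>t\<close> in [-1, 1] below the slope at z have
  length slope + 1, and integrating over z in [0, p] turns each level into a ramp. Instead of
  exchanging integrals, the proof traps the increments of both sides between \<open>q - p\<close>
  times the slopes at \<open>p\<close> and \<open>q\<close>.\<close>

lemma convex_lipschitz_representation:
  assumes f: "convex_on {0..1} f" "1-lipschitz_on {0..1} f" and p: "p \<in> {0..1}"
  shows "f p = f 0 - p + (\<integral>t. pos_part (p - slope_level f t) \<partial>level_measure)"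
proof -
  define K where "K p = (\<integral>t. pos_part (p - slope_level f t) \<partial>level_measure)" for p
  have K0: "K 0 = 0"
  proof -
    have "K 0 = (\<integral>t. 0 \<partial>level_measure)"
      unfolding K_def using slope_level_bounds(1)[of _ f]
      by (intro Bochner_Integration.integral_cong)
        (auto simp: space_restrict_space pos_part_nonpos)
    then show ?thesis by simp
  qed
  have "f p - (K p - p) = f 0 - (K 0 - 0)"
  proof (rule constant_if_le_monotone_increment
      [where D = "\<lambda>p. f p - (K p - p)" and s = "slope f", OF _ p])
    fix p q :: real assume pq: "0 \<le> p" "p \<le> q" "q \<le> 1"
    then have p: "p \<in> {0..1}" and q: "q \<in> {0..1}" by auto
    note int = integrable_pos_part_slope_level[OF p, of f] integrable_pos_part_slope_level[OF q, of f]
    note bp = integral_level_indicator[OF slope_bounds[OF f, of p], of "q - p"]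
    note bq = integral_level_indicator[OF slope_bounds[OF f, of q], of "q - p"]
    have K_diff: "K q - K p =
        (\<integral>t. pos_part (q - slope_level f t) - pos_part (p - slope_level f t) \<partial>level_measure)"
      unfolding K_def using int by simp
    \<comment> \<open>A level \<open>t \<le> slope f p\<close> is reached by \<open>p\<close>, so
      its ramp grows by the full \<open>q - p\<close>; no ramp decreases.\<close>
    have "(q - p) * (slope f p + 1) \<le> K q - K p"
      unfolding K_diff bp(2)[symmetric]
    proof (rule integral_mono[OF bp(1)])
      fix t
      show "(q - p) * indicator {..slope f p} t
          \<le> pos_part (q - slope_level f t) - pos_part (p - slope_level f t)"
        using slope_level_le[OF p, of t f] pq by (auto simp: indicator_def pos_part_def)
    qed (use int in simp)
    \<comment> \<open>A level above \<open>slope f q\<close> is not reached before \<open>q\<close>,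
      so its ramp vanishes at both points; no ramp grows by more than \<open>q - p\<close>.\<close>
    moreover have "K q - K p \<le> (q - p) * (slope f q + 1)"
      unfolding K_diff bq(2)[symmetric]
    proof (rule integral_mono[OF _ bq(1)])
      fix t assume "t \<in> space level_measure"
      then show "pos_part (q - slope_level f t) - pos_part (p - slope_level f t)
          \<le> (q - p) * indicator {..slope f q} t"
        using le_slope_if_slope_level_less[OF f _ q, of t] pq
        by (cases "slope_level f t < q") (auto simp: indicator_def pos_part_def space_restrict_space)
    qed (use int in simp)
    moreover have "(q - p) * slope f p \<le> f q - f p" "f q - f p \<le> (q - p) * slope f q"
      using slope_subgradient[OF f p q] slope_subgradient[OF f q p] by (auto simp: algebra_simps)
    ultimately show "\<bar>(f q - (K q - q)) - (f p - (K p - p))\<bar> \<le> (q - p) * (slope f q - slope f p)"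
      unfolding abs_le_iff by (simp add: algebra_simps)
  qed
  then show ?thesis using K0 by (simp add: K_def)
qed

section \<open>The representing measure\<close>

lemma clipped_relu_loss_bounded:
  assumes "0 \<le> a" "a \<le> b" "b \<le> 1" "p \<in> {0..1}" "y \<in> {0, 1}"
  shows "\<bar>clipped_relu_loss a b p y\<bar> \<le> 2"
proof -
  have pp: "0 \<le> pos_part (p - c)" "(pos_part (p - c))\<^sup>2 \<le> 1" if "0 \<le> c" for c
    using that assms by (auto simp: pos_part_def power_le_one_iff abs_square_le_1)
  have "\<bar>clip_F a b p\<bar> \<le> 1"
    using pp(2)[of a] pp(2)[of b] assms(1,2) zero_le_power2[of "pos_part (p - a)"]
      zero_le_power2[of "pos_part (p - b)"]
    unfolding clip_F_def abs_le_iff by linarith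
  moreover have "\<bar>(y - p) * clip_phi a b p\<bar> \<le> 1 * 1"
    unfolding abs_mult using assms clip_phi_bounds[of a b p] by (intro mult_mono) auto
  ultimately show ?thesis unfolding clipped_relu_loss_def by linarith
qed

theorem proposition6p1:
  "(\<forall>a b. 0 \<le> a \<and> a \<le> b \<and> b \<le> 1 \<longrightarrow> proper_loss (clipped_relu_loss a b)) \<and>
   (\<forall>L :: real \<Rightarrow> real \<Rightarrow> real.
      proper_loss L \<and>
      (\<forall>y\<in>{0, 1}. convex_on {0..1} (\<lambda>p. L p y) \<and> 1-lipschitz_on {0..1} (\<lambda>p. L p y)) \<longrightarrow>
      (\<exists>(c::real) (d::real) (\<nu> :: (real \<times> real) measure).
         finite_measure \<nu> \<and>
         sets \<nu> = sets (restrict_space borel index_set) \<and>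
         (\<forall>p\<in>{0..1}. \<forall>y\<in>{0, 1}.
            integrable \<nu> (\<lambda>(a, b). clipped_relu_loss a b p y) \<and>
            L p y = c + d * y + (\<integral>(a, b). clipped_relu_loss a b p y \<partial>\<nu>)) \<and>
         measure \<nu> index_set \<le> 5))"
proof (intro conjI allI impI; (elim conjE)?)
  fix a b :: real assume "a \<le> b"
  then show "proper_loss (clipped_relu_loss a b)" by (rule proper_clipped_relu_loss)
next
  fix L :: "real \<Rightarrow> real \<Rightarrow> real"
  assume L: "proper_loss L"
    and "\<forall>y\<in>{0, 1}. convex_on {0..1} (\<lambda>p. L p y) \<and> 1-lipschitz_on {0..1} (\<lambda>p. L p y)"
  then have conv: "convex_on {0..1} (\<lambda>p. L p 0)" "1-lipschitz_on {0..1} (\<lambda>p. L p 0)"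
    "convex_on {0..1} (\<lambda>p. L p 1)" "1-lipschitz_on {0..1} (\<lambda>p. L p 1)" by auto
  define a b where "a = slope_level (\<lambda>p. L p 0)" and "b = slope_level (\<lambda>p. L p 1)"
  \<comment> \<open>By properness, label 0 minus label 1 is nondecreasing, so the slope for label 0
    is the larger one and reaches each level first.\<close>
  have ab: "0 \<le> a t" "a t \<le> b t" "b t \<le> 1" if "t \<le> 1" for t
    using that slope_level_bounds unfolding a_def b_def
    by (auto intro!: slope_level_antimono slope_le_slope conv proper_loss_difference_mono[OF L])
  have [measurable]: "a \<in> borel_measurable level_measure" "b \<in> borel_measurable level_measure"
    by (simp_all add: a_def b_def)
  define N where "N = restrict_space (borel :: (real \<times> real) measure) index_set"
  define T where "T t = (a t, b t)" for t
  have T: "T \<in> measurable level_measure N"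
    unfolding N_def
  proof (rule measurable_restrict_space2)
    show "T \<in> space level_measure \<rightarrow> index_set"
      using ab by (auto simp: T_def index_set_def space_restrict_space)
    show "T \<in> borel_measurable level_measure"
      unfolding T_def by measurable
  qed
  define \<nu> where "\<nu> = distr level_measure N T"
  have loss_measurable: "(\<lambda>(a, b). clipped_relu_loss a b p y) \<in> borel_measurable N" for p y
  proof -
    have "(\<lambda>x. clipped_relu_loss (fst x) (snd x) p y) \<in> borel_measurable borel"
      unfolding clipped_relu_loss_def clip_F_def clip_phi_def borel_prod[symmetric] by measurable
    then show ?thesis
      unfolding N_def case_prod_beta' by (rule measurable_restrict_space1)
  qed
  have loss_integrable: "integrable level_measure (\<lambda>t. clipped_relu_loss (a t) (b t) p y)"
    if "p \<in> {0..1}" "y \<in> {0, 1}" for p y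
  proof (rule integrable_level_measure_bounded)
    show "(\<lambda>t. clipped_relu_loss (a t) (b t) p y) \<in> borel_measurable level_measure"
      unfolding clipped_relu_loss_def clip_F_def clip_phi_def by measurable
    show "\<bar>clipped_relu_loss (a t) (b t) p y\<bar> \<le> 2" if "t \<in> {-1..1}" for t
      using ab[of t] that \<open>p \<in> {0..1}\<close> \<open>y \<in> {0, 1}\<close> by (intro clipped_relu_loss_bounded) auto
  qed
  \<comment> \<open>The mixture loss to be compared with \<open>L\<close>. Properness is an
    inequality linear in the loss, so it survives integration.\<close>
  define M where "M p y = (\<integral>t. clipped_relu_loss (a t) (b t) p y \<partial>level_measure)" for p y
  have M: "proper_loss M"
    unfolding proper_loss_def
  proof (intro ballI)
    fix p q :: real assume p: "p \<in> {0..1}" and q: "q \<in> {0..1}"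
    let ?l = "\<lambda>t. clipped_relu_loss (a t) (b t)"
    have comb: "(1 - p) * M r 0 + p * M r 1 = (\<integral>t. (1 - p) * ?l t r 0 + p * ?l t r 1 \<partial>level_measure)"
      if "r \<in> {0..1}" for r
      unfolding M_def using loss_integrable[OF that] by simp
    show "(1 - p) * M p 0 + p * M p 1 \<le> (1 - p) * M q 0 + p * M q 1"
      unfolding comb[OF p] comb[OF q]
    proof (rule integral_mono)
      fix t assume "t \<in> space level_measure"
      then show "(1 - p) * ?l t p 0 + p * ?l t p 1 \<le> (1 - p) * ?l t q 0 + p * ?l t q 1"
        using proper_clipped_relu_loss[OF ab(2)[of t]] p q
        by (auto simp: proper_loss_def space_restrict_space)
    qed (use loss_integrable[OF p] loss_integrable[OF q] in auto)
  qed
  \<comment> \<open>Subtracting the two labels of a clipped loss leaves \<open>clip_phi\<close>, a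
    difference of two ramps. The terms \<open>- p\<close> in the representations of the two partial
    losses cancel, leaving only their values at 0.\<close>
  have diff: "L p 0 - L p 1 = M p 0 - M p 1 + (L 0 0 - L 0 1)" if p: "p \<in> {0..1}" for p
  proof -
    note int = integrable_pos_part_slope_level[OF p]
    have "M p 0 - M p 1 = (\<integral>t. clip_phi (a t) (b t) p \<partial>level_measure)"
      unfolding M_def
      by (subst Bochner_Integration.integral_diff[OF loss_integrable[OF p] loss_integrable[OF p], symmetric])
        (auto simp: clipped_relu_loss_def algebra_simps)
    also have "\<dots> = (\<integral>t. pos_part (p - a t) \<partial>level_measure) - (\<integral>t. pos_part (p - b t) \<partial>level_measure)"
      unfolding clip_phi_def a_def b_def using int by simp
    finally show ?thesis
      using convex_lipschitz_representation[OF conv(1,2) p]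
        convex_lipschitz_representation[OF conv(3,4) p]
      by (simp add: a_def b_def)
  qed
  obtain c d where cd: "\<And>p y. \<lbrakk>p \<in> {0..1}; y \<in> {0, 1}\<rbrakk> \<Longrightarrow> L p y = c + d * y + M p y"
    using proper_losses_with_same_difference[OF L M diff] by blast
  show "\<exists>(c::real) (d::real) (\<nu> :: (real \<times> real) measure).
         finite_measure \<nu> \<and>
         sets \<nu> = sets (restrict_space borel index_set) \<and>
         (\<forall>p\<in>{0..1}. \<forall>y\<in>{0, 1}.
            integrable \<nu> (\<lambda>(a, b). clipped_relu_loss a b p y) \<and>
            L p y = c + d * y + (\<integral>(a, b). clipped_relu_loss a b p y \<partial>\<nu>)) \<and>
         measure \<nu> index_set \<le> 5"
  proof (rule exI[of _ c], rule exI[of _ d], rule exI[of _ \<nu>], intro conjI ballI)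
    show "finite_measure \<nu>"
      unfolding \<nu>_def by (rule finite_measure.finite_measure_distr[OF finite_level_measure T])
    show "sets \<nu> = sets (restrict_space borel index_set)"
      by (simp add: \<nu>_def N_def)
    fix p y :: real assume py: "p \<in> {0..1}" "y \<in> {0, 1}"
    show "integrable \<nu> (\<lambda>(a, b). clipped_relu_loss a b p y)"
      unfolding \<nu>_def integrable_distr_eq[OF T loss_measurable]
      using loss_integrable[OF py] by (simp add: T_def)
    show "L p y = c + d * y + (\<integral>(a, b). clipped_relu_loss a b p y \<partial>\<nu>)"
      unfolding \<nu>_def integral_distr[OF T loss_measurable] using cd[OF py]
      by (simp add: T_def M_def)
  next
    have space_N: "space N = index_set" by (simp add: N_def space_restrict_space)
    \<comment> \<open>The total mass is the length of [-1, 1], which is 2.\<close>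
    have "measure \<nu> (space N) = measure level_measure (T -` space N \<inter> space level_measure)"
      unfolding \<nu>_def by (rule measure_distr[OF T sets.top])
    also have "T -` space N \<inter> space level_measure = {-1..1}"
      using measurable_space[OF T] by (auto simp: space_restrict_space)
    finally show "measure \<nu> index_set \<le> 5"
      by (simp add: space_N measure_restrict_space)
  qed
qed

end
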